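(* Let $X,Y$ be two totally ordered sets, and suppose $X$ is finite. Let $R\subseteq R'\subseteq X\times Y$ be two nonempty relations, and let $E_R,F_R,E_{R'},F_{R'}$ be their associated simplicial complexes. Then there exist homotopy equivalences $\Gamma_{|E_R|}:|F_R|\to|E_R|$ and $\Gamma_{|E_{R'}|}:|F_{R'}|\to|E_{R'}|$ that commute up to homotopy with the canonical inclusions $i:E_R\hookrightarrow E_{R'}$ and $j:F_R\hookrightarrow F_{R'}$, i.e. $|i|\circ\Gamma_{|E_R|}\simeq\Gamma_{|E_{R'}|}\circ|j|$.
   Context: For a nonempty relation $R\subseteq X\times Y$, the simplicial complexes $E_R$ and $F_R$ are defined as follows. A (nonempty) finite subset $\sigma\subseteq X$ is a simplex of $E_R$ whenever there exists $y\in Y$ such that $(x,y)\in R$ for each $x\in\sigma$. A (nonempty) finite subset $\tau\subseteq Y$ is a simplex of $F_R$ whenever there exists $x\in X$ such that $(x,y)\in R$ for each $y\in\tau$. $|\Sigma|$ denotes the geometric realization of a simplicial complex $\Sigma$ with the weak topology, and $|f|$ the map induced on geometric realizations by a simplicial map $f$. $\simeq$ denotes homotopy of maps. *)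

theory Defs
  imports "HOL-Analysis.Analysis"
begin

text \<open>
  An abstract simplicial complex is represented by its set of simplices, each a nonempty finite set
  of vertices. The vertex set is \<^term>\<open>\<Union>K\<close>, so points of the ambient type lying in no simplex are
  not vertices.
\<close>

definition abstract_complex :: "'a set set \<Rightarrow> bool" where
  "abstract_complex K \<longleftrightarrow>
     (\<forall>\<sigma>\<in>K. finite \<sigma> \<and> \<sigma> \<noteq> {}) \<and> (\<forall>\<sigma>\<in>K. \<forall>\<tau>. \<tau> \<subseteq> \<sigma> \<and> \<tau> \<noteq> {} \<longrightarrow> \<tau> \<in> K)"

definition simplicial_map :: "'a set set \<Rightarrow> 'b set set \<Rightarrow> ('a \<Rightarrow> 'b) \<Rightarrow> bool" where
  "simplicial_map K L f \<longleftrightarrow> (\<forall>\<sigma>\<in>K. f ` \<sigma> \<in> L)"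

definition complex_E :: "'a set \<Rightarrow> 'b set \<Rightarrow> ('a \<times> 'b) set \<Rightarrow> 'a set set" where
  "complex_E X Y R =
     {\<sigma>. finite \<sigma> \<and> \<sigma> \<noteq> {} \<and> \<sigma> \<subseteq> X \<and> (\<exists>y\<in>Y. \<forall>x\<in>\<sigma>. (x, y) \<in> R)}"

definition complex_F :: "'a set \<Rightarrow> 'b set \<Rightarrow> ('a \<times> 'b) set \<Rightarrow> 'b set set" where
  "complex_F X Y R =
     {\<tau>. finite \<tau> \<and> \<tau> \<noteq> {} \<and> \<tau> \<subseteq> Y \<and> (\<exists>x\<in>X. \<forall>y\<in>\<tau>. (x, y) \<in> R)}"

lemma abstract_complex_E: "abstract_complex (complex_E X Y R)"
  unfolding abstract_complex_def complex_E_def by (blast intro: finite_subset)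

lemma abstract_complex_F: "abstract_complex (complex_F X Y R)"
  unfolding abstract_complex_def complex_F_def by (blast intro: finite_subset)

lemma simplicial_map_inclusion_E:
  "R \<subseteq> R' \<Longrightarrow> simplicial_map (complex_E X Y R) (complex_E X Y R') (\<lambda>x. x)"
proof -
  assume "R \<subseteq> R'"
  then have "(\<exists>y\<in>Y. \<forall>x\<in>\<sigma>. (x, y) \<in> R) \<longrightarrow> (\<exists>y\<in>Y. \<forall>x\<in>\<sigma>. (x, y) \<in> R')" for \<sigma>
    by blast
  then show ?thesis
    by (simp add: simplicial_map_def complex_E_def)
qed

lemma simplicial_map_inclusion_F:
  "R \<subseteq> R' \<Longrightarrow> simplicial_map (complex_F X Y R) (complex_F X Y R') (\<lambda>y. y)"
proof -
  assume "R \<subseteq> R'"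
  then have "(\<exists>x\<in>X. \<forall>y\<in>\<sigma>. (x, y) \<in> R) \<longrightarrow> (\<exists>x\<in>X. \<forall>y\<in>\<sigma>. (x, y) \<in> R')" for \<sigma>
    by blast
  then show ?thesis
    by (simp add: simplicial_map_def complex_F_def)
qed

text \<open>Points of the realization are given by their barycentric coordinates.\<close>

definition realized_simplex :: "'a set \<Rightarrow> ('a \<Rightarrow> real) set" where
  "realized_simplex \<sigma> =
     {\<alpha>. (\<forall>v. 0 \<le> \<alpha> v) \<and> (\<forall>v. v \<notin> \<sigma> \<longrightarrow> \<alpha> v = 0) \<and> (\<Sum>v\<in>\<sigma>. \<alpha> v) = 1}"

definition realization_points :: "'a set set \<Rightarrow> ('a \<Rightarrow> real) set" where
  "realization_points K = (\<Union>\<sigma>\<in>K. realized_simplex \<sigma>)"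

text \<open>
  A realized simplex is supported on its finitely many vertices, so the subspace topology inherited
  from the product topology is its Euclidean topology. In the weak topology, a set is open iff its
  trace on every simplex is open in that Euclidean topology. For infinite \<^term>\<open>K\<close> this is in general
  finer than the subspace topology of \<^term>\<open>realization_points K\<close>.
\<close>

definition simplex_topology :: "'a set \<Rightarrow> ('a \<Rightarrow> real) topology" where
  "simplex_topology \<sigma> = subtopology (powertop_real UNIV) (realized_simplex \<sigma>)"

definition realization :: "'a set set \<Rightarrow> ('a \<Rightarrow> real) topology" where
  "realization K = topology (\<lambda>U. U \<subseteq> realization_points K \<and>
     (\<forall>\<sigma>\<in>K. openin (simplex_topology \<sigma>) (U \<inter> realized_simplex \<sigma>)))"

lemma openin_realization:
  "openin (realization K) U \<longleftrightarrow> U \<subseteq> realization_points K \<and>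
     (\<forall>\<sigma>\<in>K. openin (simplex_topology \<sigma>) (U \<inter> realized_simplex \<sigma>))"
proof -
  have "istopology (\<lambda>U. U \<subseteq> realization_points K \<and>
     (\<forall>\<sigma>\<in>K. openin (simplex_topology \<sigma>) (U \<inter> realized_simplex \<sigma>)))"
    unfolding istopology_def
  proof (intro conjI allI impI ballI)
    fix S T \<sigma>
    assume S: "S \<subseteq> realization_points K \<and>
        (\<forall>\<sigma>\<in>K. openin (simplex_topology \<sigma>) (S \<inter> realized_simplex \<sigma>))"
      and T: "T \<subseteq> realization_points K \<and>
        (\<forall>\<sigma>\<in>K. openin (simplex_topology \<sigma>) (T \<inter> realized_simplex \<sigma>))"
    show "S \<inter> T \<subseteq> realization_points K" using S by blast
    assume "\<sigma> \<in> K"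
    then have "openin (simplex_topology \<sigma>) (S \<inter> realized_simplex \<sigma>)"
      and "openin (simplex_topology \<sigma>) (T \<inter> realized_simplex \<sigma>)"
      using S T by simp_all
    then have "openin (simplex_topology \<sigma>)
        ((S \<inter> realized_simplex \<sigma>) \<inter> (T \<inter> realized_simplex \<sigma>))"
      by (rule openin_Int)
    then show "openin (simplex_topology \<sigma>) (S \<inter> T \<inter> realized_simplex \<sigma>)"
      by (simp add: Int_ac)
  next
    fix \<U> \<sigma>
    assume \<U>: "\<forall>U\<in>\<U>. U \<subseteq> realization_points K \<and>
        (\<forall>\<sigma>\<in>K. openin (simplex_topology \<sigma>) (U \<inter> realized_simplex \<sigma>))"
    show "\<Union>\<U> \<subseteq> realization_points K" using \<U> by blast
    assume "\<sigma> \<in> K"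
    then have "openin (simplex_topology \<sigma>) (\<Union>U\<in>\<U>. U \<inter> realized_simplex \<sigma>)"
      using \<U> by (intro openin_Union) auto
    then show "openin (simplex_topology \<sigma>) (\<Union>\<U> \<inter> realized_simplex \<sigma>)"
      by (simp only: Int_Union2)
  qed
  then show ?thesis
    by (simp add: realization_def)
qed

lemma topspace_simplex_topology: "topspace (simplex_topology \<sigma>) = realized_simplex \<sigma>"
  by (simp add: simplex_topology_def)

lemma topspace_realization: "topspace (realization K) = realization_points K"
proof
  show "topspace (realization K) \<subseteq> realization_points K"
    using openin_realization openin_topspace by blast
  have "realization_points K \<inter> realized_simplex \<sigma> = realized_simplex \<sigma>" if "\<sigma> \<in> K" for \<sigma>
    using that by (auto simp: realization_points_def)
  then have "openin (realization K) (realization_points K)"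
    unfolding openin_realization
    by (metis openin_topspace order_refl topspace_simplex_topology)
  then show "realization_points K \<subseteq> topspace (realization K)"
    by (rule openin_subset)
qed

text \<open>
  The affine extension of a vertex map. Points of a realization have finite support, and the sum is
  restricted to the support because the fibres of \<^term>\<open>f\<close> may be infinite.
\<close>

definition realization_map :: "('a \<Rightarrow> 'b) \<Rightarrow> ('a \<Rightarrow> real) \<Rightarrow> ('b \<Rightarrow> real)" where
  "realization_map f \<alpha> = (\<lambda>w. \<Sum>v | \<alpha> v \<noteq> 0 \<and> f v = w. \<alpha> v)"

lemma realization_map_ident: "realization_map (\<lambda>x. x) \<alpha> = \<alpha>"
proof
  fix w
  have "{v. \<alpha> v \<noteq> 0 \<and> v = w} = (if \<alpha> w = 0 then {} else {w})" by auto
  then show "realization_map (\<lambda>x. x) \<alpha> w = \<alpha> w"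
    by (simp add: realization_map_def)
qed

definition homotopy_equivalence_map :: "'a topology \<Rightarrow> 'b topology \<Rightarrow> ('a \<Rightarrow> 'b) \<Rightarrow> bool" where
  "homotopy_equivalence_map S T f \<longleftrightarrow>
     continuous_map S T f \<and>
     (\<exists>g. continuous_map T S g \<and>
          homotopic_with (\<lambda>_. True) S S (g \<circ> f) id \<and>
          homotopic_with (\<lambda>_. True) T T (f \<circ> g) id)"

end

theory Submission
  imports Defs
begin

text \<open>
  No subdivision is needed: there is an explicit map \<open>|F\<^sub>R| \<rightarrow> |E\<^sub>R|\<close>. It sends \<open>\<beta>\<close> to the point
  whose \<open>x\<close>-coordinate is proportional to \<open>max \<beta> - max {\<beta> y | (x, y) \<notin> R}\<close>. This is positive iff \<open>x\<close>
  is related to every vertex at which \<open>\<beta>\<close> is maximal, and it is largest possible iff \<open>x\<close> is related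
  to the whole support of \<open>\<beta>\<close>. The map \<open>|E\<^sub>R| \<rightarrow> |F\<^sub>R|\<close> is given by the same formula, restricted to
  finitely many \<open>y\<close>, one witness for each of the finitely many simplices of \<open>E\<^sub>R\<close>. The two
  descriptions of the image, by its support and by its maximal vertices, show that both composites
  are contiguous to the identity, and that enlarging \<open>R\<close> only enlarges the support of the image of
  \<open>\<beta>\<close>. Hence all the homotopies can be taken to be straight lines.
\<close>

section \<open>Continuity for the weak topology\<close>

definition bary_support :: "('a \<Rightarrow> real) \<Rightarrow> 'a set" where
  "bary_support \<alpha> = {v. \<alpha> v \<noteq> 0}"

lemma
  assumes "abstract_complex K" "\<sigma> \<in> K"
  shows abstract_complex_finite: "finite \<sigma>"
    and abstract_complex_nonempty: "\<sigma> \<noteq> {}"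
    and abstract_complex_face: "\<tau> \<subseteq> \<sigma> \<Longrightarrow> \<tau> \<noteq> {} \<Longrightarrow> \<tau> \<in> K"
  using assms unfolding abstract_complex_def by blast+

lemma realized_simplex_iff:
  assumes "finite \<sigma>"
  shows "\<alpha> \<in> realized_simplex \<sigma> \<longleftrightarrow>
    bary_support \<alpha> \<subseteq> \<sigma> \<and> (\<forall>v. 0 \<le> \<alpha> v) \<and> (\<Sum>v\<in>bary_support \<alpha>. \<alpha> v) = 1"
proof -
  have "(\<Sum>v\<in>\<sigma>. \<alpha> v) = (\<Sum>v\<in>bary_support \<alpha>. \<alpha> v)" if "bary_support \<alpha> \<subseteq> \<sigma>"
    using that assms by (intro sum.mono_neutral_right) (auto simp: bary_support_def)
  moreover have "(\<forall>v. v \<notin> \<sigma> \<longrightarrow> \<alpha> v = 0) \<longleftrightarrow> bary_support \<alpha> \<subseteq> \<sigma>"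
    by (auto simp: bary_support_def)
  ultimately show ?thesis
    unfolding realized_simplex_def by auto
qed

text \<open>The support is the smallest simplex that can carry a point, so by closure under faces it
  suffices to test this one simplex. It is nonempty because an empty sum is not 1.\<close>

lemma realization_points_iff:
  assumes "abstract_complex K"
  shows "\<alpha> \<in> realization_points K \<longleftrightarrow>
    bary_support \<alpha> \<in> K \<and> (\<forall>v. 0 \<le> \<alpha> v) \<and> (\<Sum>v\<in>bary_support \<alpha>. \<alpha> v) = 1"
proof
  assume "\<alpha> \<in> realization_points K"
  then obtain \<sigma> where \<sigma>: "\<sigma> \<in> K" "\<alpha> \<in> realized_simplex \<sigma>"
    by (auto simp: realization_points_def)
  then have *: "bary_support \<alpha> \<subseteq> \<sigma> \<and> (\<forall>v. 0 \<le> \<alpha> v) \<and> (\<Sum>v\<in>bary_support \<alpha>. \<alpha> v) = 1"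
    using assms by (simp add: realized_simplex_iff abstract_complex_finite)
  then have "bary_support \<alpha> \<noteq> {}"
    by force
  with * \<sigma> assms show "bary_support \<alpha> \<in> K \<and> (\<forall>v. 0 \<le> \<alpha> v) \<and> (\<Sum>v\<in>bary_support \<alpha>. \<alpha> v) = 1"
    using abstract_complex_face by blast
next
  assume *: "bary_support \<alpha> \<in> K \<and> (\<forall>v. 0 \<le> \<alpha> v) \<and> (\<Sum>v\<in>bary_support \<alpha>. \<alpha> v) = 1"
  then have "\<alpha> \<in> realized_simplex (bary_support \<alpha>)"
    using assms by (simp add: realized_simplex_iff abstract_complex_finite)
  with * show "\<alpha> \<in> realization_points K"
    by (auto simp: realization_points_def)
qed

lemma realized_simplex_subset_realization_points:
  "\<sigma> \<in> K \<Longrightarrow> realized_simplex \<sigma> \<subseteq> realization_points K"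
  by (auto simp: realization_points_def)

section \<open>Maps out of and into a realization\<close>

lemma continuous_map_simplex_coordinate:
  "continuous_map (simplex_topology \<sigma>) euclideanreal (\<lambda>\<alpha>. \<alpha> v)"
  unfolding simplex_topology_def
  by (intro continuous_map_from_subtopology continuous_map_product_projection) simp

text \<open>The weak topology is the final topology for the inclusions of the simplices, so open
  preimages are tested one simplex at a time.\<close>

lemma continuous_map_from_realization:
  "continuous_map (realization K) T f \<longleftrightarrow> (\<forall>\<sigma>\<in>K. continuous_map (simplex_topology \<sigma>) T f)"
proof -
  have eq: "{x \<in> realization_points K. f x \<in> U} \<inter> realized_simplex \<sigma> = {x \<in> realized_simplex \<sigma>. f x \<in> U}"
    if "\<sigma> \<in> K" for \<sigma> U
    using realized_simplex_subset_realization_points[OF that] by auto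
  have "f \<in> realization_points K \<rightarrow> topspace T \<longleftrightarrow> (\<forall>\<sigma>\<in>K. f \<in> realized_simplex \<sigma> \<rightarrow> topspace T)"
    by (auto simp: realization_points_def)
  then show ?thesis
    by (simp add: continuous_map_def topspace_realization topspace_simplex_topology
        openin_realization eq cong: ball_cong) blast
qed

lemma continuous_map_realization_coordinate:
  "continuous_map (realization K) euclideanreal (\<lambda>\<alpha>. \<alpha> v)"
  by (simp add: continuous_map_from_realization continuous_map_simplex_coordinate)

text \<open>A simplex is cut out by closed conditions on coordinates and on one finite sum. This
  turns closedness within a simplex into closedness in the whole product.\<close>

lemma closedin_realized_simplex:
  assumes "finite \<sigma>"
  shows "closedin (powertop_real UNIV) (realized_simplex \<sigma>)"
proof -
  have cont: "continuous_map (powertop_real UNIV) euclideanreal (\<lambda>\<alpha>. \<alpha> v)" for v :: 'a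
    by (rule continuous_map_product_projection) simp
  have 1: "closedin (powertop_real UNIV) {\<alpha>. 0 \<le> \<alpha> v}" for v :: 'a
    using closedin_continuous_map_preimage[OF cont[of v], of "{0..}"] by simp
  have 2: "closedin (powertop_real UNIV) {\<alpha>. \<alpha> v = 0}" for v :: 'a
    using closedin_continuous_map_preimage[OF cont[of v], of "{0}"] by simp
  have "continuous_map (powertop_real UNIV) euclideanreal (\<lambda>\<alpha>. \<Sum>v\<in>\<sigma>. \<alpha> v)"
    using assms cont by (intro continuous_map_sum)
  from closedin_continuous_map_preimage[OF this, of "{1}"]
  have 3: "closedin (powertop_real UNIV) {\<alpha>. (\<Sum>v\<in>\<sigma>. \<alpha> v) = 1}"
    by simp
  have "realized_simplex \<sigma> = {\<alpha>. (\<Sum>v\<in>\<sigma>. \<alpha> v) = 1} \<inter>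
    \<Inter> (insert UNIV (range (\<lambda>v. {\<alpha>. 0 \<le> \<alpha> v}) \<union> (\<lambda>v. {\<alpha>. \<alpha> v = 0}) ` (- \<sigma>)))"
    by (auto simp: realized_simplex_def)
  moreover have "closedin (powertop_real UNIV) (UNIV :: ('a \<Rightarrow> real) set)"
    using closedin_topspace[of "powertop_real (UNIV :: 'a set)"] by simp
  ultimately show ?thesis
    using 1 2 3 by (simp only:) (intro closedin_Int closedin_Inter, auto)
qed

text \<open>
  Only finitely many simplices have all their vertices in \<open>V\<close>, and over finitely many simplices the
  weak topology is the product topology.
\<close>

lemma continuous_map_into_realization:
  assumes K: "abstract_complex K" and "finite V"
    and im: "\<And>a. a \<in> topspace T \<Longrightarrow> f a \<in> realization_points K"
    and supp: "\<And>a. a \<in> topspace T \<Longrightarrow> bary_support (f a) \<subseteq> V"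
    and coord: "\<And>v. continuous_map T euclideanreal (\<lambda>a. f a v)"
  shows "continuous_map T (realization K) f"
  unfolding continuous_map_closedin
proof (intro conjI ballI allI impI)
  show "f \<in> topspace T \<rightarrow> topspace (realization K)"
    using im by (simp add: topspace_realization)
  fix C
  assume C: "closedin (realization K) C"
  \<comment> \<open>The finite union \<open>D\<close> is closed in the product topology, where
    \<open>f\<close> is known to be continuous. On the image of \<open>f\<close> it agrees with
    \<open>C\<close>, since each \<open>f a\<close> lies in the simplex spanned by its support, a
    subset of \<open>V\<close>.\<close>
  define D where "D = (\<Union>\<sigma>\<in>K \<inter> Pow V. C \<inter> realized_simplex \<sigma>)"
  have f: "continuous_map T (powertop_real UNIV) f"
    using coord by (simp add: continuous_map_componentwise_UNIV)
  have "closedin (powertop_real UNIV) (C \<inter> realized_simplex \<sigma>)" if "\<sigma> \<in> K" for \<sigma>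
  proof -
    have "continuous_map (simplex_topology \<sigma>) (realization K) id"
      using continuous_map_from_realization[of K "realization K" id] that by simp
    from closedin_continuous_map_preimage[OF this C]
    have "closedin (simplex_topology \<sigma>) (C \<inter> realized_simplex \<sigma>)"
      by (simp add: topspace_simplex_topology Int_def conj_commute)
    then show ?thesis
      using closedin_realized_simplex[OF abstract_complex_finite[OF K that]] closedin_trans_full
      by (auto simp: simplex_topology_def)
  qed
  then have "closedin (powertop_real UNIV) D"
    unfolding D_def using \<open>finite V\<close> by (intro closedin_Union) auto
  from closedin_continuous_map_preimage[OF f this]
  have "closedin T {a \<in> topspace T. f a \<in> D}" .
  moreover have "f a \<in> D \<longleftrightarrow> f a \<in> C" if "a \<in> topspace T" for a
  proof -
    have *: "bary_support (f a) \<in> K"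
      using im[OF that] K by (simp add: realization_points_iff)
    moreover have "f a \<in> realized_simplex (bary_support (f a))"
      using im[OF that] K by (simp add: realization_points_iff realized_simplex_iff abstract_complex_finite)
    ultimately show ?thesis
      using supp[OF that] by (auto simp: D_def)
  qed
  ultimately show "closedin T {a \<in> topspace T. f a \<in> C}"
    by (simp cong: conj_cong)
qed

text \<open>Compactness of neighbourhoods in the interval is what makes the product weak as well.\<close>

lemma continuous_map_from_prod_realization:
  assumes h: "\<And>\<sigma>. \<sigma> \<in> K \<Longrightarrow>
    continuous_map (prod_topology (top_of_set {0..1::real}) (simplex_topology \<sigma>)) T h"
  shows "continuous_map (prod_topology (top_of_set {0..1::real}) (realization K)) T h"
  unfolding continuous_map_def
proof (intro conjI allI impI)
  show "h \<in> topspace (prod_topology (top_of_set {0..1}) (realization K)) \<rightarrow> topspace T"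
    using h by (fastforce simp: continuous_map_def topspace_realization topspace_simplex_topology
        realization_points_def)
  fix W
  assume W: "openin T W"
  define Q where "Q = {z \<in> topspace (prod_topology (top_of_set {0..1}) (realization K)). h z \<in> W}"
  have Q\<sigma>: "openin (prod_topology (top_of_set {0..1}) (simplex_topology \<sigma>))
      (Q \<inter> {0..1} \<times> realized_simplex \<sigma>)" if "\<sigma> \<in> K" for \<sigma>
  proof -
    have "Q \<inter> {0..1} \<times> realized_simplex \<sigma> =
      {z \<in> topspace (prod_topology (top_of_set {0..1}) (simplex_topology \<sigma>)). h z \<in> W}"
      using realized_simplex_subset_realization_points[OF that]
      by (auto simp: Q_def topspace_realization topspace_simplex_topology)
    then show ?thesis
      using openin_continuous_map_preimage[OF h[OF that] W] by simp
  qed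
  show "openin (prod_topology (top_of_set {0..1}) (realization K)) Q"
    unfolding openin_prod_topology_alt
  proof (intro allI impI)
    fix t \<beta>
    assume tb: "(t, \<beta>) \<in> Q"
    then have t: "t \<in> {0..1}" and "\<beta> \<in> realization_points K"
      by (auto simp: Q_def topspace_realization)
    then obtain \<sigma> where \<sigma>: "\<sigma> \<in> K" "\<beta> \<in> realized_simplex \<sigma>"
      by (auto simp: realization_points_def)
    with tb t have "(t, \<beta>) \<in> Q \<inter> {0..1} \<times> realized_simplex \<sigma>"
      by simp
    from Q\<sigma>[OF \<sigma>(1), unfolded openin_prod_topology_alt, rule_format, OF this]
    obtain A B where AB: "openin (top_of_set {0..1}) A" "t \<in> A" "\<beta> \<in> B" "A \<times> B \<subseteq> Q"
      by auto
    then obtain e where e: "e > 0" "ball t e \<inter> {0..1} \<subseteq> A"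
      unfolding openin_contains_ball by blast
    \<comment> \<open>\<open>B\<close> is open only in the simplex \<open>\<sigma>\<close>, so a
      neighbourhood of \<open>\<beta>\<close> in the realization has to be built anew. From the box
      only \<open>A \<times> {\<beta>} \<subseteq> Q\<close> is kept, and \<open>A\<close> is shrunk
      to a compact neighbourhood of \<open>t\<close>.\<close>
    define J where "J = cball t (e/2) \<inter> {0..1}"
    have J: "J \<subseteq> A" "J \<subseteq> {0..1}"
      using e by (auto simp: J_def)
    have "compact J"
      by (simp add: J_def compact_Int)
    then have cJ: "compact_space (top_of_set J)"
      by (simp add: compact_space_subtopology)
    define U where "U = {\<gamma> \<in> realization_points K. J \<times> {\<gamma>} \<subseteq> Q}"
    have "openin (simplex_topology \<tau>) (U \<inter> realized_simplex \<tau>)" if "\<tau> \<in> K" for \<tau>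
    proof -
      let ?P = "prod_topology (top_of_set J) (simplex_topology \<tau>)"
      have "continuous_map ?P (prod_topology (top_of_set {0..1}) (simplex_topology \<tau>)) id"
        using J by (auto simp: id_def case_prod_unfold
            intro!: continuous_map_pairedI[where f=fst and g=snd, simplified]
            continuous_map_into_subtopology continuous_map_snd
            continuous_map_fst[THEN continuous_map_into_fulltopology])
      from openin_continuous_map_preimage[OF this Q\<sigma>[OF that]]
      have "openin ?P (Q \<inter> J \<times> realized_simplex \<tau>)"
        using J by (auto simp: topspace_simplex_topology elim!: back_subst[of "openin ?P"])
      \<comment> \<open>Tube lemma: the points of \<open>\<tau>\<close> outside \<open>U\<close> are
        the projection of this closed set, and projection along the compact \<open>J\<close> is a
        closed map.\<close>
      then have "closedin ?P (J \<times> realized_simplex \<tau> - Q)"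
        by (simp add: closedin_def topspace_simplex_topology Diff_Diff_Int Int_commute)
      then have "closedin (simplex_topology \<tau>) (snd ` (J \<times> realized_simplex \<tau> - Q))"
        using closed_map_snd[OF cJ] by (auto simp: closed_map_def)
      moreover have "realized_simplex \<tau> - snd ` (J \<times> realized_simplex \<tau> - Q) = U \<inter> realized_simplex \<tau>"
        using realized_simplex_subset_realization_points[OF that]
        by (force simp: U_def)
      ultimately show ?thesis
        by (metis closedin_def topspace_simplex_topology)
    qed
    then have "openin (realization K) U"
      by (auto simp: openin_realization U_def)
    moreover have "openin (top_of_set {0..1}) (ball t (e/2) \<inter> {0..1})"
      by (simp add: openin_open_Int Int_commute)
    moreover have "\<beta> \<in> U"
      using J AB \<open>\<beta> \<in> realization_points K\<close> by (auto simp: U_def)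
    moreover have "(ball t (e/2) \<inter> {0..1}) \<times> U \<subseteq> Q"
      by (auto simp: U_def J_def subset_iff)
    ultimately show "\<exists>A B. openin (top_of_set {0..1}) A \<and> openin (realization K) B \<and>
        t \<in> A \<and> \<beta> \<in> B \<and> A \<times> B \<subseteq> Q"
      using t e by (metis IntI centre_in_ball half_gt_zero)
  qed
qed

text \<open>By \<open>common\<close>, each segment from \<open>p \<alpha>\<close> to
  \<open>q \<alpha>\<close> stays in one simplex of \<open>K\<close>. By \<open>finV\<close>, only
  finitely many vertices of \<open>K\<close> occur over a simplex of \<open>L\<close>, so continuity
  of the homotopy there can be checked on coordinates even when \<open>K\<close> is
  infinite.\<close>

lemma homotopic_straight_line:
  assumes K: "abstract_complex K"
    and p: "continuous_map (realization L) (realization K) p"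
    and q: "continuous_map (realization L) (realization K) q"
    and finV: "\<And>\<sigma>. \<sigma> \<in> L \<Longrightarrow>
      \<exists>V. finite V \<and> (\<forall>\<alpha>\<in>realized_simplex \<sigma>. bary_support (p \<alpha>) \<union> bary_support (q \<alpha>) \<subseteq> V)"
    and common: "\<And>\<alpha>. \<alpha> \<in> realization_points L \<Longrightarrow> bary_support (p \<alpha>) \<union> bary_support (q \<alpha>) \<in> K"
  shows "homotopic_with (\<lambda>_. True) (realization L) (realization K) p q"
  unfolding homotopic_with_def
proof (intro exI conjI)
  define h where "h = (\<lambda>(t::real, \<alpha>) v. (1 - t) * p \<alpha> v + t * q \<alpha> v)"
  show "\<forall>\<alpha>. h (0, \<alpha>) = p \<alpha>" "\<forall>\<alpha>. h (1, \<alpha>) = q \<alpha>"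
    by (auto simp: h_def)
  have sub: "bary_support (h (t, \<alpha>)) \<subseteq> bary_support (p \<alpha>) \<union> bary_support (q \<alpha>)" for t \<alpha>
    by (auto simp: h_def bary_support_def)
  have im: "h (t, \<alpha>) \<in> realization_points K" if "t \<in> {0..1}" "\<alpha> \<in> realization_points L" for t \<alpha>
  proof -
    let ?\<sigma> = "bary_support (p \<alpha>) \<union> bary_support (q \<alpha>)"
    have fin: "finite ?\<sigma>"
      using abstract_complex_finite[OF K common[OF that(2)]] .
    have "p \<alpha> \<in> realization_points K" "q \<alpha> \<in> realization_points K"
      using p q that(2) by (auto simp: continuous_map_def topspace_realization)
    then have "p \<alpha> \<in> realized_simplex ?\<sigma>" "q \<alpha> \<in> realized_simplex ?\<sigma>"
      using K fin by (auto simp: realization_points_iff realized_simplex_iff)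
    then have "h (t, \<alpha>) \<in> realized_simplex ?\<sigma>"
      using that(1)
      by (auto simp: realized_simplex_def h_def sum.distrib simp flip: sum_distrib_left)
    then show ?thesis
      using common[OF that(2)] by (auto simp: realization_points_def)
  qed
  show "continuous_map (prod_topology (top_of_set {0..1}) (realization L)) (realization K) h"
  proof (rule continuous_map_from_prod_realization)
    fix \<sigma>
    assume \<sigma>: "\<sigma> \<in> L"
    let ?P = "prod_topology (top_of_set {0..1::real}) (simplex_topology \<sigma>)"
    obtain V where V: "finite V"
      "\<forall>\<alpha>\<in>realized_simplex \<sigma>. bary_support (p \<alpha>) \<union> bary_support (q \<alpha>) \<subseteq> V"
      using finV[OF \<sigma>] by blast
    show "continuous_map ?P (realization K) h"
    proof (rule continuous_map_into_realization[OF K V(1)])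
      fix z
      assume z: "z \<in> topspace ?P"
      then show "h z \<in> realization_points K"
        using im realized_simplex_subset_realization_points[OF \<sigma>]
        by (cases z) (auto simp: topspace_simplex_topology)
      show "bary_support (h z) \<subseteq> V"
        using z V(2) sub by (cases z) (fastforce simp: topspace_simplex_topology)
    next
      fix v
      have coord: "continuous_map ?P euclideanreal (\<lambda>z. f (snd z) v)"
        if "continuous_map (realization L) (realization K) f" for f
      proof -
        have "continuous_map (simplex_topology \<sigma>) (realization K) f"
          using that \<sigma> by (simp add: continuous_map_from_realization)
        from continuous_map_compose[OF continuous_map_compose[OF continuous_map_snd this]
            continuous_map_realization_coordinate[of K v]]
        show ?thesis
          by (simp add: o_def)
      qed
      have fst: "continuous_map ?P euclideanreal fst"
        using continuous_map_fst continuous_map_into_fulltopology by blast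
      have "continuous_map ?P euclideanreal (\<lambda>z. (1 - fst z) * p (snd z) v + fst z * q (snd z) v)"
        using coord[OF p] coord[OF q] fst
        by (intro continuous_map_add continuous_map_real_mult continuous_map_diff) auto
      then show "continuous_map ?P euclideanreal (\<lambda>z. h z v)"
        by (simp add: h_def case_prod_unfold)
    qed
  qed
qed auto

section \<open>The Dowker maps\<close>

definition max_vertices :: "('a \<Rightarrow> real) \<Rightarrow> 'a set" where
  "max_vertices \<alpha> = {v. \<forall>u. \<alpha> u \<le> \<alpha> v}"

text \<open>
  The supremum of \<open>\<alpha>\<close> on \<open>A\<close>. Intersecting with the support makes the set finite; the \<open>0\<close> accounts for
  the omitted points and for \<open>A = {}\<close>.
\<close>

definition peak :: "'a set \<Rightarrow> ('a \<Rightarrow> real) \<Rightarrow> real" where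
  "peak A \<alpha> = Max (insert 0 (\<alpha> ` (A \<inter> bary_support \<alpha>)))"

definition gap :: "('w \<Rightarrow> 'v \<Rightarrow> bool) \<Rightarrow> ('v \<Rightarrow> real) \<Rightarrow> 'w \<Rightarrow> real" where
  "gap P \<alpha> w = peak UNIV \<alpha> - peak {v. \<not> P w v} \<alpha>"

text \<open>Keeping \<open>W\<close> and \<open>P\<close> as parameters lets one construction serve
  both directions: \<open>P\<close> is \<open>R\<close> or its converse, and \<open>W\<close> is a
  finite set of vertices of the target.\<close>

definition dowker_map :: "'w set \<Rightarrow> ('w \<Rightarrow> 'v \<Rightarrow> bool) \<Rightarrow> ('v \<Rightarrow> real) \<Rightarrow> 'w \<Rightarrow> real" where
  "dowker_map W P \<alpha> w = (if w \<in> W then gap P \<alpha> w / (\<Sum>u\<in>W. gap P \<alpha> u) else 0)"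

section \<open>Bounds on peaks and their continuity on a simplex\<close>

lemma peak_nonneg: "finite (bary_support \<alpha>) \<Longrightarrow> 0 \<le> peak A \<alpha>"
  by (simp add: peak_def)

lemma peak_upper: "finite (bary_support \<alpha>) \<Longrightarrow> v \<in> A \<Longrightarrow> \<alpha> v \<le> peak A \<alpha>"
  by (cases "\<alpha> v = 0") (auto simp: peak_def bary_support_def intro!: Max_ge)

lemma peak_attained:
  assumes "finite (bary_support \<alpha>)" "peak A \<alpha> > 0"
  obtains v where "v \<in> A" "\<alpha> v = peak A \<alpha>"
proof -
  have "peak A \<alpha> \<in> insert 0 (\<alpha> ` (A \<inter> bary_support \<alpha>))"
    unfolding peak_def using assms(1) by (intro Max_in) auto
  then show thesis
    using that assms(2) by auto
qed

lemma peak_mono: "finite (bary_support \<alpha>) \<Longrightarrow> A \<subseteq> B \<Longrightarrow> peak A \<alpha> \<le> peak B \<alpha>"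
  unfolding peak_def by (intro Max_mono) auto

text \<open>The support varies with the point, but on \<open>\<sigma>\<close> nonnegativity makes
  the peak equal to the maximum over the fixed finite set \<open>A \<inter> \<sigma>\<close>, hence
  a maximum of finitely many coordinates. If that set is empty, the peak is constantly 0.\<close>

lemma continuous_map_peak:
  assumes "finite \<sigma>"
  shows "continuous_map (simplex_topology \<sigma>) euclideanreal (peak A)"
proof (cases "A \<inter> \<sigma> = {}")
  case True
  have "peak A \<alpha> = 0" if "\<alpha> \<in> realized_simplex \<sigma>" for \<alpha>
  proof -
    have "A \<inter> bary_support \<alpha> = {}"
      using that True assms by (auto simp: realized_simplex_iff)
    then show ?thesis
      by (simp add: peak_def)
  qed
  then show ?thesis
    using continuous_map_eq[of "simplex_topology \<sigma>" euclideanreal "\<lambda>_. 0" "peak A"]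
    by (simp add: topspace_simplex_topology)
next
  case False
  have "(SUP v\<in>A \<inter> \<sigma>. \<alpha> v) = peak A \<alpha>" if \<alpha>: "\<alpha> \<in> realized_simplex \<sigma>" for \<alpha>
  proof -
    have supp: "bary_support \<alpha> \<subseteq> \<sigma>" and nonneg: "0 \<le> \<alpha> v" for v
      using \<alpha> assms by (auto simp: realized_simplex_iff)
    have fin: "finite (bary_support \<alpha>)"
      using supp assms finite_subset by blast
    have "Max (\<alpha> ` (A \<inter> \<sigma>)) = peak A \<alpha>"
    proof (rule antisym)
      show "Max (\<alpha> ` (A \<inter> \<sigma>)) \<le> peak A \<alpha>"
        using False assms peak_upper[OF fin] by simp
      obtain v where v: "v \<in> A \<inter> \<sigma>"
        using False by blast
      have "\<alpha> v \<le> Max (\<alpha> ` (A \<inter> \<sigma>))"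
        using assms v by simp
      then have "0 \<le> Max (\<alpha> ` (A \<inter> \<sigma>))"
        using nonneg[of v] by linarith
      then show "peak A \<alpha> \<le> Max (\<alpha> ` (A \<inter> \<sigma>))"
        unfolding peak_def using fin assms supp by auto
    qed
    then show ?thesis
      using False assms by (simp add: cSup_eq_Max)
  qed
  moreover have "continuous_map (simplex_topology \<sigma>) euclideanreal (\<lambda>\<alpha>. SUP v\<in>A \<inter> \<sigma>. \<alpha> v)"
    using assms by (intro continuous_map_Sup continuous_map_simplex_coordinate) auto
  ultimately show ?thesis
    by (metis (lifting) continuous_map_eq topspace_simplex_topology)
qed

section \<open>Support and maximal vertices of the image of a single point\<close>

context
  fixes W :: "'w set" and P :: "'w \<Rightarrow> 'v \<Rightarrow> bool" and \<alpha> :: "'v \<Rightarrow> real" and w\<^sub>0 :: 'w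
  assumes finW: "finite W"
    and fin: "finite (bary_support \<alpha>)"
    and nonneg: "\<And>v. 0 \<le> \<alpha> v"
    and nonempty: "bary_support \<alpha> \<noteq> {}"
    and w\<^sub>0: "w\<^sub>0 \<in> W" "\<And>v. v \<in> bary_support \<alpha> \<Longrightarrow> P w\<^sub>0 v"
begin

lemma peak_UNIV_pos: "0 < peak UNIV \<alpha>"
proof -
  obtain v where "\<alpha> v \<noteq> 0"
    using nonempty by (auto simp: bary_support_def)
  then show ?thesis
    using nonneg[of v] peak_upper[OF fin, of v UNIV] by simp
qed

lemma max_vertices_iff: "v \<in> max_vertices \<alpha> \<longleftrightarrow> \<alpha> v = peak UNIV \<alpha>"
proof -
  obtain u where "\<alpha> u = peak UNIV \<alpha>"
    using peak_attained[OF fin peak_UNIV_pos] by blast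
  then show ?thesis
    using peak_upper[OF fin, of _ UNIV] by (auto simp: max_vertices_def intro!: antisym) metis
qed

lemma gap_nonneg: "0 \<le> gap P \<alpha> w"
  using peak_mono[OF fin, of _ UNIV] by (simp add: gap_def)

lemma gap_le: "gap P \<alpha> w \<le> peak UNIV \<alpha>"
  using peak_nonneg[OF fin] by (simp add: gap_def)

text \<open>The two peaks cancel exactly when some vertex unrelated to \<open>w\<close> already
  attains the global maximum; positivity of that maximum ensures that the equal peak is attained at
  a vertex.\<close>

lemma gap_eq_0_iff: "gap P \<alpha> w = 0 \<longleftrightarrow> (\<exists>v\<in>max_vertices \<alpha>. \<not> P w v)"
proof
  assume "gap P \<alpha> w = 0"
  then have "peak {v. \<not> P w v} \<alpha> = peak UNIV \<alpha>"
    by (simp add: gap_def)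
  then show "\<exists>v\<in>max_vertices \<alpha>. \<not> P w v"
    using peak_attained[OF fin, of "{v. \<not> P w v}"] peak_UNIV_pos
    by (metis max_vertices_iff mem_Collect_eq)
next
  assume "\<exists>v\<in>max_vertices \<alpha>. \<not> P w v"
  then obtain v where "\<alpha> v = peak UNIV \<alpha>" "\<not> P w v"
    by (auto simp: max_vertices_iff)
  then have "gap P \<alpha> w \<le> 0"
    using peak_upper[OF fin, of v "{v. \<not> P w v}"] by (simp add: gap_def)
  then show "gap P \<alpha> w = 0"
    using gap_nonneg[of w] by simp
qed

text \<open>Nothing is subtracted exactly when all vertices unrelated to \<open>w\<close> have
  coordinate 0.\<close>

lemma gap_eq_peak_iff: "gap P \<alpha> w = peak UNIV \<alpha> \<longleftrightarrow> (\<forall>v\<in>bary_support \<alpha>. P w v)"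
proof
  assume "gap P \<alpha> w = peak UNIV \<alpha>"
  then have "peak {v. \<not> P w v} \<alpha> = 0"
    by (simp add: gap_def)
  then have "\<not> P w v \<Longrightarrow> \<alpha> v = 0" for v
    using peak_upper[OF fin, of v "{v. \<not> P w v}"] nonneg[of v] by simp
  then show "\<forall>v\<in>bary_support \<alpha>. P w v"
    by (auto simp: bary_support_def)
next
  assume "\<forall>v\<in>bary_support \<alpha>. P w v"
  then have "{v. \<not> P w v} \<inter> bary_support \<alpha> = {}"
    by auto
  then show "gap P \<alpha> w = peak UNIV \<alpha>"
    by (simp add: gap_def peak_def)
qed

text \<open>The vertex \<open>w\<^sub>0\<close> is related to the whole support, so its gap is the
  full positive peak, and no other gap is negative.\<close>

lemma sum_gap_pos: "0 < (\<Sum>u\<in>W. gap P \<alpha> u)"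
  using finW w\<^sub>0 gap_eq_peak_iff[of w\<^sub>0] peak_UNIV_pos gap_nonneg
  by (intro sum_pos2[of W w\<^sub>0]) auto

lemma dowker_map_nonneg: "0 \<le> dowker_map W P \<alpha> w"
  using gap_nonneg sum_gap_pos by (simp add: dowker_map_def)

lemma bary_support_dowker_map:
  "bary_support (dowker_map W P \<alpha>) = {w \<in> W. \<forall>v\<in>max_vertices \<alpha>. P w v}"
  using sum_gap_pos gap_eq_0_iff by (auto simp: bary_support_def dowker_map_def)

lemma max_vertices_dowker_map:
  "max_vertices (dowker_map W P \<alpha>) = {w \<in> W. \<forall>v\<in>bary_support \<alpha>. P w v}"
proof -
  let ?S = "\<Sum>u\<in>W. gap P \<alpha> u"
  \<comment> \<open>The coordinate at \<open>w\<^sub>0\<close> attains the bound valid for all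
    coordinates, so the maximal vertices are those attaining it. The bound is positive, which
    excludes vertices outside \<open>W\<close>.\<close>
  have w0: "dowker_map W P \<alpha> w\<^sub>0 = peak UNIV \<alpha> / ?S"
    using gap_eq_peak_iff[of w\<^sub>0] w\<^sub>0 by (simp add: dowker_map_def)
  have le: "dowker_map W P \<alpha> w \<le> peak UNIV \<alpha> / ?S" for w
    using gap_le[of w] sum_gap_pos peak_UNIV_pos by (simp add: dowker_map_def divide_right_mono)
  have "w \<in> max_vertices (dowker_map W P \<alpha>) \<longleftrightarrow> dowker_map W P \<alpha> w = peak UNIV \<alpha> / ?S" for w
  proof
    assume "w \<in> max_vertices (dowker_map W P \<alpha>)"
    then have "dowker_map W P \<alpha> w\<^sub>0 \<le> dowker_map W P \<alpha> w"
      by (simp add: max_vertices_def)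
    with w0 le[of w] show "dowker_map W P \<alpha> w = peak UNIV \<alpha> / ?S"
      by simp
  qed (use le in \<open>simp add: max_vertices_def\<close>)
  moreover have "dowker_map W P \<alpha> w = peak UNIV \<alpha> / ?S \<longleftrightarrow> w \<in> W \<and> gap P \<alpha> w = peak UNIV \<alpha>" for w
    using sum_gap_pos peak_UNIV_pos by (auto simp: dowker_map_def)
  ultimately show ?thesis
    by (auto simp: gap_eq_peak_iff)
qed

lemma sum_dowker_map: "(\<Sum>w\<in>bary_support (dowker_map W P \<alpha>). dowker_map W P \<alpha> w) = 1"
proof -
  have "(\<Sum>w\<in>bary_support (dowker_map W P \<alpha>). dowker_map W P \<alpha> w) = (\<Sum>w\<in>W. dowker_map W P \<alpha> w)"
    using finW by (intro sum.mono_neutral_left) (auto simp: bary_support_def dowker_map_def)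
  also have "\<dots> = (\<Sum>w\<in>W. gap P \<alpha> w / (\<Sum>u\<in>W. gap P \<alpha> u))"
    by (simp add: dowker_map_def)
  also have "\<dots> = 1"
    using sum_gap_pos by (simp flip: sum_divide_distrib)
  finally show ?thesis .
qed

end

text \<open>Applied to the support of \<open>\<alpha>\<close>, \<open>star\<close> supplies the
  vertex required in the one-point analysis. The maximal vertices form a nonempty face of the
  support, so \<open>star\<close> conditions apply to them too.\<close>

lemma dowker_map_realization_point:
  assumes K: "abstract_complex K" and W: "finite W"
    and star: "\<And>\<sigma>. \<sigma> \<in> K \<Longrightarrow> {w \<in> W. \<forall>v\<in>\<sigma>. P w v} \<noteq> {}"
    and \<alpha>: "\<alpha> \<in> realization_points K"
  shows "bary_support (dowker_map W P \<alpha>) = {w \<in> W. \<forall>v\<in>max_vertices \<alpha>. P w v}"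
    and "max_vertices (dowker_map W P \<alpha>) = {w \<in> W. \<forall>v\<in>bary_support \<alpha>. P w v}"
    and "0 \<le> dowker_map W P \<alpha> w"
    and "(\<Sum>w\<in>bary_support (dowker_map W P \<alpha>). dowker_map W P \<alpha> w) = 1"
    and "max_vertices \<alpha> \<in> K"
    and "0 < (\<Sum>u\<in>W. gap P \<alpha> u)"
proof -
  have supp: "bary_support \<alpha> \<in> K" and nonneg: "\<And>v. 0 \<le> \<alpha> v"
    using \<alpha> K by (auto simp: realization_points_iff)
  have fin: "finite (bary_support \<alpha>)" and ne: "bary_support \<alpha> \<noteq> {}"
    using supp K abstract_complex_finite abstract_complex_nonempty by blast+
  obtain w0 where w0: "w0 \<in> W" "\<And>v. v \<in> bary_support \<alpha> \<Longrightarrow> P w0 v"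
    using star[OF supp] by blast
  note hyps = W fin nonneg ne w0
  show "bary_support (dowker_map W P \<alpha>) = {w \<in> W. \<forall>v\<in>max_vertices \<alpha>. P w v}"
    "max_vertices (dowker_map W P \<alpha>) = {w \<in> W. \<forall>v\<in>bary_support \<alpha>. P w v}"
    "0 \<le> dowker_map W P \<alpha> w"
    "(\<Sum>w\<in>bary_support (dowker_map W P \<alpha>). dowker_map W P \<alpha> w) = 1"
    "0 < (\<Sum>u\<in>W. gap P \<alpha> u)"
    using bary_support_dowker_map[of W \<alpha> w0 P] max_vertices_dowker_map[of W \<alpha> w0 P]
      dowker_map_nonneg[of W \<alpha> w0 P w] sum_dowker_map[of W \<alpha> w0 P] sum_gap_pos[of W \<alpha> w0 P] hyps
    by blast+
  have pos: "0 < peak UNIV \<alpha>" and max: "v \<in> max_vertices \<alpha> \<longleftrightarrow> \<alpha> v = peak UNIV \<alpha>" for v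
    using peak_UNIV_pos[of W \<alpha> w0 P] max_vertices_iff[of W \<alpha> w0 P v] hyps by blast+
  have "max_vertices \<alpha> \<subseteq> bary_support \<alpha>"
    using max pos by (auto simp: bary_support_def)
  moreover have "max_vertices \<alpha> \<noteq> {}"
    using max peak_attained[OF fin pos] by blast
  ultimately show "max_vertices \<alpha> \<in> K"
    using abstract_complex_face[OF K supp] by blast
qed

text \<open>The image of a point is supported on the common neighbours of its maximal vertices, a
  simplex of \<open>L\<close> by \<open>star\<close>. All supports lie in the finite set
  \<open>W\<close>, so coordinates suffice; on each simplex they are quotients of continuous
  functions with positive denominator, or 0.\<close>

lemma continuous_map_dowker_map:
  assumes K: "abstract_complex K" and L: "abstract_complex L" and W: "finite W"
    and star: "\<And>\<sigma>. \<sigma> \<in> K \<Longrightarrow> {w \<in> W. \<forall>v\<in>\<sigma>. P w v} \<in> L"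
  shows "continuous_map (realization K) (realization L) (dowker_map W P)"
proof (rule continuous_map_into_realization[OF L W])
  have star': "{w \<in> W. \<forall>v\<in>\<sigma>. P w v} \<noteq> {}" if "\<sigma> \<in> K" for \<sigma>
    using abstract_complex_nonempty[OF L star[OF that]] .
  note pt = dowker_map_realization_point[OF K W star']
  show "dowker_map W P \<alpha> \<in> realization_points L"
    "bary_support (dowker_map W P \<alpha>) \<subseteq> W" if "\<alpha> \<in> topspace (realization K)" for \<alpha>
    using that pt star L by (auto simp: topspace_realization realization_points_iff)
  fix w
  show "continuous_map (realization K) euclideanreal (\<lambda>\<alpha>. dowker_map W P \<alpha> w)"
    unfolding continuous_map_from_realization
  proof
    fix \<sigma>
    assume \<sigma>: "\<sigma> \<in> K"
    then have "finite \<sigma>"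
      using K abstract_complex_finite by blast
    then have gap: "continuous_map (simplex_topology \<sigma>) euclideanreal (\<lambda>\<alpha>. gap P \<alpha> u)" for u
      unfolding gap_def by (intro continuous_map_diff continuous_map_peak)
    have "(\<Sum>u\<in>W. gap P \<alpha> u) \<noteq> 0" if "\<alpha> \<in> topspace (simplex_topology \<sigma>)" for \<alpha>
      using pt(6)[of \<alpha>] that realized_simplex_subset_realization_points[OF \<sigma>]
      by (auto simp: topspace_simplex_topology)
    then have "continuous_map (simplex_topology \<sigma>) euclideanreal (\<lambda>\<alpha>. gap P \<alpha> w / (\<Sum>u\<in>W. gap P \<alpha> u))"
      using W gap by (intro continuous_map_real_divide continuous_map_sum) auto
    then show "continuous_map (simplex_topology \<sigma>) euclideanreal (\<lambda>\<alpha>. dowker_map W P \<alpha> w)"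
      by (simp add: dowker_map_def)
  qed
qed

section \<open>The homotopy equivalence and its compatibility with inclusions\<close>

lemma common_neighbours_in_complex_E:
  assumes X: "finite X" and \<tau>: "\<tau> \<in> complex_F X Y R" and "R \<subseteq> S" "S \<subseteq> R'"
  shows "{x \<in> X. \<forall>y\<in>\<tau>. (x, y) \<in> S} \<in> complex_E X Y R'"
proof -
  have "\<tau> \<noteq> {}" "\<tau> \<subseteq> Y" and ex: "\<exists>x\<in>X. \<forall>y\<in>\<tau>. (x, y) \<in> R"
    using \<tau> by (simp_all add: complex_F_def)
  then obtain y where y: "y \<in> \<tau>" "y \<in> Y"
    by blast
  \<comment> \<open>Any vertex of \<open>\<tau>\<close> witnesses that its common neighbours span a
    simplex.\<close>
  have "\<exists>y\<in>Y. \<forall>x\<in>{x \<in> X. \<forall>y\<in>\<tau>. (x, y) \<in> S}. (x, y) \<in> R'"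
    using y \<open>S \<subseteq> R'\<close> by blast
  moreover have "{x \<in> X. \<forall>y\<in>\<tau>. (x, y) \<in> S} \<noteq> {}"
    using ex \<open>R \<subseteq> S\<close> by blast
  ultimately show ?thesis
    using X unfolding complex_E_def by simp
qed

lemma dowker_homotopy_equivalence:
  assumes X: "finite X"
  shows "homotopy_equivalence_map (realization (complex_F X Y R)) (realization (complex_E X Y R))
    (dowker_map X (\<lambda>x y. (x, y) \<in> R))"
proof -
  let ?E = "complex_E X Y R" and ?F = "complex_F X Y R"
  note E = abstract_complex_E[of X Y R] and F = abstract_complex_F[of X Y R]
  have "\<forall>\<sigma>\<in>?E. \<exists>y. y \<in> Y \<and> (\<forall>x\<in>\<sigma>. (x, y) \<in> R)"
    by (auto simp: complex_E_def)
  then obtain c where c: "\<And>\<sigma>. \<sigma> \<in> ?E \<Longrightarrow> c \<sigma> \<in> Y" "\<And>\<sigma> x. \<sigma> \<in> ?E \<Longrightarrow> x \<in> \<sigma> \<Longrightarrow> (x, c \<sigma>) \<in> R"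
    by metis
  \<comment> \<open>\<open>Y\<close> may be infinite, but finiteness of \<open>X\<close> leaves only
    finitely many simplices in \<open>?E\<close>, and one witness for each is enough to define
    \<open>g\<close>.\<close>
  define Y0 where "Y0 = c ` ?E"
  have "?E \<subseteq> Pow X"
    by (auto simp: complex_E_def)
  then have "finite ?E"
    using X finite_subset by blast
  then have Y0: "finite Y0" "Y0 \<subseteq> Y"
    using c(1) by (auto simp: Y0_def)
  define f where "f = dowker_map X (\<lambda>x y. (x, y) \<in> R)"
  define g where "g = dowker_map Y0 (\<lambda>y x. (x, y) \<in> R)"
  have starF: "{x \<in> X. \<forall>y\<in>\<tau>. (x, y) \<in> R} \<in> ?E" if "\<tau> \<in> ?F" for \<tau>
    using common_neighbours_in_complex_E[OF X that] by blast
  have starE: "{y \<in> Y0. \<forall>x\<in>\<sigma>. (x, y) \<in> R} \<in> ?F" if \<sigma>: "\<sigma> \<in> ?E" for \<sigma>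
  proof -
    have "c \<sigma> \<in> {y \<in> Y0. \<forall>x\<in>\<sigma>. (x, y) \<in> R}"
      using \<sigma> c by (auto simp: Y0_def)
    moreover obtain x where "x \<in> X" "x \<in> \<sigma>"
      using \<sigma> unfolding complex_E_def by blast
    ultimately show ?thesis
      using Y0 unfolding complex_F_def by (simp, blast)
  qed
  have f: "continuous_map (realization ?F) (realization ?E) f"
    unfolding f_def using E F X starF by (intro continuous_map_dowker_map)
  have g: "continuous_map (realization ?E) (realization ?F) g"
    unfolding g_def using E F Y0 starE by (intro continuous_map_dowker_map)
  have f_pt: "f \<beta> \<in> realization_points ?E" if "\<beta> \<in> realization_points ?F" for \<beta>
    using f that by (auto simp: continuous_map_def topspace_realization)
  have g_pt: "g \<alpha> \<in> realization_points ?F" if "\<alpha> \<in> realization_points ?E" for \<alpha>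
    using g that by (auto simp: continuous_map_def topspace_realization)
  have f_supp: "bary_support (f \<beta>) = {x \<in> X. \<forall>y\<in>max_vertices \<beta>. (x, y) \<in> R}"
    and f_max: "max_vertices (f \<beta>) = {x \<in> X. \<forall>y\<in>bary_support \<beta>. (x, y) \<in> R}"
    if "\<beta> \<in> realization_points ?F" for \<beta>
    using dowker_map_realization_point(1,2)[OF F X _ that, of "\<lambda>x y. (x, y) \<in> R"]
      abstract_complex_nonempty[OF E starF]
    unfolding f_def by blast+
  have g_supp: "bary_support (g \<alpha>) = {y \<in> Y0. \<forall>x\<in>max_vertices \<alpha>. (x, y) \<in> R}"
    and g_max: "max_vertices (g \<alpha>) = {y \<in> Y0. \<forall>x\<in>bary_support \<alpha>. (x, y) \<in> R}"
    if "\<alpha> \<in> realization_points ?E" for \<alpha>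
    using dowker_map_realization_point(1,2)[OF E Y0(1) _ that, of "\<lambda>y x. (x, y) \<in> R"]
      abstract_complex_nonempty[OF F starE]
    unfolding g_def by blast+
  have supp_E: "bary_support \<alpha> \<in> ?E" if "\<alpha> \<in> realization_points ?E" for \<alpha>
    using that E by (simp add: realization_points_iff)
  have supp_F: "bary_support \<beta> \<in> ?F" if "\<beta> \<in> realization_points ?F" for \<beta>
    using that F by (simp add: realization_points_iff)
  have "homotopic_with (\<lambda>_. True) (realization ?E) (realization ?E) (f \<circ> g) id"
  proof (rule homotopic_straight_line[OF E continuous_map_compose[OF g f] continuous_map_id])
    fix \<alpha>
    assume \<alpha>: "\<alpha> \<in> realization_points ?E"
    have "bary_support \<alpha> \<subseteq> X"
      using supp_E[OF \<alpha>] by (simp add: complex_E_def)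
    \<comment> \<open>The maximal vertices of \<open>g \<alpha>\<close> are related to every vertex
      in the support of \<open>\<alpha>\<close>, so all these vertices reappear in the support of
      \<open>f (g \<alpha>)\<close>.\<close>
    then have "bary_support \<alpha> \<subseteq> bary_support ((f \<circ> g) \<alpha>)"
      by (auto simp: f_supp g_pt g_max \<alpha>)
    then show "bary_support ((f \<circ> g) \<alpha>) \<union> bary_support (id \<alpha>) \<in> ?E"
      using supp_E[OF f_pt[OF g_pt[OF \<alpha>]]] by (simp add: Un_absorb2)
  next
    fix \<sigma>
    assume \<sigma>: "\<sigma> \<in> ?E"
    have "bary_support ((f \<circ> g) \<alpha>) \<union> bary_support (id \<alpha>) \<subseteq> X" if "\<alpha> \<in> realized_simplex \<sigma>" for \<alpha>
    proof -
      have "\<alpha> \<in> realization_points ?E"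
        using that \<sigma> by (auto simp: realization_points_def)
      from supp_E[OF this] supp_E[OF f_pt[OF g_pt[OF this]]] show ?thesis
        by (auto simp: complex_E_def)
    qed
    then show "\<exists>V. finite V \<and> (\<forall>\<alpha>\<in>realized_simplex \<sigma>.
        bary_support ((f \<circ> g) \<alpha>) \<union> bary_support (id \<alpha>) \<subseteq> V)"
      using X by blast
  qed
  moreover have "homotopic_with (\<lambda>_. True) (realization ?F) (realization ?F) (g \<circ> f) id"
  proof (rule homotopic_straight_line[OF F continuous_map_compose[OF f g] continuous_map_id])
    fix \<beta>
    assume \<beta>: "\<beta> \<in> realization_points ?F"
    \<comment> \<open>Here the supports need not be nested, since that of \<open>\<beta>\<close> may
      leave \<open>Y0\<close>. Instead \<open>x\<close> is a maximal vertex of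
      \<open>f \<beta>\<close>, hence related to the support of \<open>g (f \<beta>)\<close> as
      well, and so witnesses that the union is a simplex.\<close>
    obtain x where x: "x \<in> X" "\<forall>y\<in>bary_support \<beta>. (x, y) \<in> R"
      using supp_F[OF \<beta>] by (auto simp: complex_F_def)
    then have "\<forall>y\<in>bary_support ((g \<circ> f) \<beta>). (x, y) \<in> R"
      by (simp add: g_supp f_pt f_max \<beta>)
    with x supp_F[OF \<beta>] supp_F[OF g_pt[OF f_pt[OF \<beta>]]]
    show "bary_support ((g \<circ> f) \<beta>) \<union> bary_support (id \<beta>) \<in> ?F"
      unfolding complex_F_def by auto
  next
    fix \<tau>
    assume \<tau>: "\<tau> \<in> ?F"
    have "bary_support ((g \<circ> f) \<beta>) \<union> bary_support (id \<beta>) \<subseteq> Y0 \<union> \<tau>"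
      if "\<beta> \<in> realized_simplex \<tau>" for \<beta>
    proof -
      have "\<beta> \<in> realization_points ?F"
        using that \<tau> by (auto simp: realization_points_def)
      moreover have "bary_support \<beta> \<subseteq> \<tau>"
        using that \<tau> by (simp add: realized_simplex_iff complex_F_def)
      ultimately show ?thesis
        by (auto simp: g_supp f_pt)
    qed
    moreover have "finite (Y0 \<union> \<tau>)"
      using \<tau> Y0 by (simp add: complex_F_def)
    ultimately show "\<exists>V. finite V \<and> (\<forall>\<beta>\<in>realized_simplex \<tau>.
        bary_support ((g \<circ> f) \<beta>) \<union> bary_support (id \<beta>) \<subseteq> V)"
      by blast
  qed
  ultimately show ?thesis
    using f g unfolding homotopy_equivalence_map_def f_def by blast
qed

theorem theorem24:
  fixes X :: "'a set" and Y :: "'b set"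
    and leX :: "'a rel" and leY :: "'b rel"
    and R R' :: "('a \<times> 'b) set"
  assumes "linear_order_on X leX"
    and "linear_order_on Y leY"
    and "finite X"
    and "R \<noteq> {}"
    and "R' \<noteq> {}"
    and "R \<subseteq> R'"
    and "R' \<subseteq> X \<times> Y"
  shows "\<exists>\<Gamma> \<Gamma>'.
    homotopy_equivalence_map (realization (complex_F X Y R)) (realization (complex_E X Y R)) \<Gamma> \<and>
    homotopy_equivalence_map (realization (complex_F X Y R')) (realization (complex_E X Y R')) \<Gamma>' \<and>
    homotopic_with (\<lambda>_. True)
      (realization (complex_F X Y R)) (realization (complex_E X Y R'))
      (realization_map (\<lambda>x. x) \<circ> \<Gamma>) (\<Gamma>' \<circ> realization_map (\<lambda>y. y))"
proof (intro exI conjI)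
  let ?f = "dowker_map X (\<lambda>x y. (x, y) \<in> R)" and ?f' = "dowker_map X (\<lambda>x y. (x, y) \<in> R')"
  let ?F = "complex_F X Y R" and ?E' = "complex_E X Y R'"
  note X = \<open>finite X\<close>
  show "homotopy_equivalence_map (realization ?F) (realization (complex_E X Y R)) ?f"
    "homotopy_equivalence_map (realization (complex_F X Y R')) (realization ?E') ?f'"
    using X by (rule dowker_homotopy_equivalence)+
  note F = abstract_complex_F[of X Y R] and E' = abstract_complex_E[of X Y R']
  \<comment> \<open>Both Dowker maps are regarded as maps from the realization of \<open>?F\<close>
    to that of \<open>?E'\<close>, where they can be compared.\<close>
  have star: "{x \<in> X. \<forall>y\<in>\<tau>. (x, y) \<in> R} \<in> ?E'"
    and star': "{x \<in> X. \<forall>y\<in>\<tau>. (x, y) \<in> R'} \<in> ?E'" if "\<tau> \<in> ?F" for \<tau>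
    using common_neighbours_in_complex_E[OF X that] \<open>R \<subseteq> R'\<close> by blast+
  \<comment> \<open>The maximal vertices of \<open>\<beta>\<close> do not depend on the relation, so
    the support for \<open>R\<close> is contained in that for \<open>R'\<close>; the latter is a
    simplex of \<open>?E'\<close> by \<open>star'\<close>.\<close>
  have supp: "bary_support (?f \<beta>) \<union> bary_support (?f' \<beta>) = {x \<in> X. \<forall>y\<in>max_vertices \<beta>. (x, y) \<in> R'}"
    if \<beta>: "\<beta> \<in> realization_points ?F" for \<beta>
    using dowker_map_realization_point(1)[OF F X abstract_complex_nonempty[OF E' star] \<beta>]
      dowker_map_realization_point(1)[OF F X abstract_complex_nonempty[OF E' star'] \<beta>] \<open>R \<subseteq> R'\<close> by auto
  have "homotopic_with (\<lambda>_. True) (realization ?F) (realization ?E') ?f ?f'"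
  proof (rule homotopic_straight_line[OF E'])
    show "continuous_map (realization ?F) (realization ?E') ?f"
      "continuous_map (realization ?F) (realization ?E') ?f'"
      by (rule continuous_map_dowker_map[OF F E' X], erule star star')+
    show "bary_support (?f \<beta>) \<union> bary_support (?f' \<beta>) \<in> ?E'" if "\<beta> \<in> realization_points ?F" for \<beta>
      using dowker_map_realization_point(5)[OF F X abstract_complex_nonempty[OF E' star] that] star' by (simp add: supp that)
    show "\<exists>V. finite V \<and> (\<forall>\<beta>\<in>realized_simplex \<tau>. bary_support (?f \<beta>) \<union> bary_support (?f' \<beta>) \<subseteq> V)"
      if "\<tau> \<in> ?F" for \<tau>
      using X supp that by (intro exI[of _ X]) (auto simp: realization_points_def)
  qed
  moreover have "realization_map (\<lambda>x. x) \<circ> ?f = ?f" "?f' \<circ> realization_map (\<lambda>y. y) = ?f'"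
    by (simp_all add: fun_eq_iff realization_map_ident)
  ultimately show "homotopic_with (\<lambda>_. True) (realization ?F) (realization ?E')
      (realization_map (\<lambda>x. x) \<circ> ?f) (?f' \<circ> realization_map (\<lambda>y. y))"
    by simp
qed

end
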